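(* Let $\alpha>0$, let $G$ have the Fréchet distribution with index $\alpha$, let $W_n=(M_n-b_n)/a_n$ be the renormalized maximum with score function $\rho_n$, as described in the context, and let $\varphi_h=\mathcal{T}_\alpha^{-1}h$ be the solution of the Stein equation given in the context. For all $h$ such that $\varphi_h\in\mathcal{F}(f_n)$ we have $$E\,h(W_n)-E\,h(G)=\alpha\, E\left[\varphi_h(W_n)\left(1-W_n^{\alpha}\left(\frac{\alpha+1}{\alpha}+\frac{W_n}{\alpha}\rho_n(W_n)\right)\right)\right].$$
   Context: Fix $\alpha>0$. The Fréchet cumulative distribution function with index $\alpha$ is $\Phi_\alpha(x)=\exp(-x^{-\alpha})\mathbb{I}(x\ge 0)$; $G$ is a random variable with this distribution. Setting for $W_n$: $X_1,X_2,\ldots$ are independent random variables with common distribution function $F$, $M_n=\max(X_1,\ldots,X_n)$, and $a_n>0$, $b_n$ are normalizing constants such that $P[(M_n-b_n)/a_n\le x]=F(a_nx+b_n)^n\to\Phi_\alpha(x)$ as $n\to\infty$. Put $W_n=(M_n-b_n)/a_n$. Let $\mathcal{S}=\{x: F'(x)>0\}$ and suppose that $\mathcal{S}$ is an interval with closure $\bar{\mathcal{S}}=[a,b]$; write $f=F'$. Let $f_n$ be the probability density function of $W_n$, supposed differentiable on the interval $\mathcal{S}$ except perhaps in a finite number of points. The score function of $W_n$ is $$\rho_n(x)=(\log f_n(x))'=a_n\left((n-1)\frac{f(a_nx+b_n)}{F(a_nx+b_n)}+\frac{f'(a_nx+b_n)}{f(a_nx+b_n)}\right).$$ $\mathcal{F}(f_n)$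 is the collection of all differentiable functions $\varphi$ on $\mathbb{R}$ such that $\lim_{x\to a^{+}}\varphi(x)x^{\alpha+1}f_n(x)=\lim_{x\to b^{-}}\varphi(x)x^{\alpha+1}f_n(x)=0$. Stein equation: let $\mathcal{F}(\alpha)$ be the collection of all differentiable functions $\varphi$ on $\mathbb{R}$ such that $\lim_{x\to\infty}\varphi(x)e^{-x^{-\alpha}}=\lim_{x\to 0}\varphi(x)e^{-x^{-\alpha}}=0$, and for $\varphi\in\mathcal{F}(\alpha)$ define $\mathcal{T}_\alpha\varphi(x)=\varphi'(x)x^{\alpha+1}+\alpha\varphi(x)$. For a function $h$ with $E|h(G)|<\infty$, $\varphi_h=\mathcal{T}_\alpha^{-1}h$ denotes the solution of $h(x)-E\,h(G)=\mathcal{T}_\alpha\varphi(x)$ given by $$\varphi_h(x)=e^{x^{-\alpha}}\int_0^x\left(h(y)-E[h(G)]\right)y^{-\alpha-1}e^{-y^{-\alpha}}\,dy$$ or, equivalently, $$\varphi_h(x)=e^{x^{-\alpha}}\int_x^\infty\left(E[h(G)]-h(y)\right)y^{-\alpha-1}e^{-y^{-\alpha}}\,dy,$$ for all $x\ge 0$.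
   Formalization: The limits defining F(f_n) are taken at the rescaled endpoints (a-b_n)/a_n and (b-b_n)/a_n, since with a and b themselves the identity can fail; the support of W_n is assumed nonnegative, so that W_n^α and φ_h(W_n) are defined, and the expectations are assumed to exist. *)

theory Defs
  imports "HOL-Probability.Probability"
begin

text \<open>The value at 0 is the limit \<open>exp (-\<infinity>) = 0\<close>; since \<open>0 powr (- \<alpha>) = 0\<close> in HOL,
  the closed condition \<open>0 \<le> x\<close> would wrongly give 1 there.\<close>

definition frechet_cdf :: "real \<Rightarrow> real \<Rightarrow> real" where
  "frechet_cdf \<alpha> x = (if 0 < x then exp (- (x powr (- \<alpha>))) else 0)"

text \<open>The derivative of a distribution function where it exists, and 0 elsewhere
  (\<^const>\<open>deriv\<close> is an unspecified number at points of non-differentiability).\<close>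

definition pdf_of :: "(real \<Rightarrow> real) \<Rightarrow> real \<Rightarrow> real" where
  "pdf_of H x = (if H differentiable (at x) then deriv H x else 0)"

definition score :: "(real \<Rightarrow> real) \<Rightarrow> real \<Rightarrow> real" where
  "score g x = deriv (\<lambda>y. ln (g y)) x"

definition renorm_max ::
  "(nat \<Rightarrow> 'm \<Rightarrow> real) \<Rightarrow> (nat \<Rightarrow> real) \<Rightarrow> (nat \<Rightarrow> real) \<Rightarrow> nat \<Rightarrow> 'm \<Rightarrow> real" where
  "renorm_max X a b n \<omega> = (Max ((\<lambda>i. X i \<omega>) ` {1..n}) - b n) / a n"

text \<open>The class \<open>\<F>(g)\<close> for a density \<open>g\<close> whose support has the (possibly infinite)
  endpoints \<open>l\<close> and \<open>u\<close>.\<close>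

definition stein_class ::
  "real \<Rightarrow> (real \<Rightarrow> real) \<Rightarrow> ereal \<Rightarrow> ereal \<Rightarrow> (real \<Rightarrow> real) set" where
  "stein_class \<alpha> g l u =
     {\<phi>. \<phi> differentiable_on UNIV \<and>
         (((\<lambda>x. \<phi> x * x powr (\<alpha> + 1) * g x) \<circ> real_of_ereal) \<longlongrightarrow> 0) (at_right l) \<and>
         (((\<lambda>x. \<phi> x * x powr (\<alpha> + 1) * g x) \<circ> real_of_ereal) \<longlongrightarrow> 0) (at_left u)}"

text \<open>The solution \<open>\<phi>\<^sub>h\<close> of the Stein equation for the Frechet law, where \<open>m\<close> stands for
  \<open>E h(G)\<close>. The formula is meaningful for \<open>0 < x\<close> only.\<close>

definition frechet_stein :: "real \<Rightarrow> real \<Rightarrow> (real \<Rightarrow> real) \<Rightarrow> real \<Rightarrow> real" where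
  "frechet_stein \<alpha> m h x =
     exp (x powr (- \<alpha>)) *
       (LBINT y:{0..x}. (h y - m) * y powr (- \<alpha> - 1) * exp (- (y powr (- \<alpha>))))"

text \<open>A function given on the positive half-line belongs to a class of functions on the whole
  line if some member of the class extends it. Extending \<open>\<phi>\<^sub>h\<close> by a fixed value on
  \<open>x \<le> 0\<close> instead would in general destroy differentiability at 0.\<close>

definition extends_into :: "(real \<Rightarrow> real) \<Rightarrow> (real \<Rightarrow> real) set \<Rightarrow> bool" where
  "extends_into f C \<longleftrightarrow> (\<exists>\<phi>\<in>C. \<forall>x>0. \<phi> x = f x)"

end

theory Submission
  imports Defs "HOL-Real_Asymp.Real_Asymp"
begin

text \<open>Integration by parts proves the identity. Let \<open>m = E h(G)\<close>, let \<open>g\<close> be the density of \<open>W\<close>,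
positive on the interval \<open>(l, u)\<close> with \<open>0 \<le> l\<close> and zero almost everywhere outside it, and let
\<open>\<phi>\<close> be a differentiable extension of the Stein solution. Almost everywhere on \<open>(l, u)\<close> the
derivative of \<open>\<Psi> x = \<phi> x * x powr (\<alpha> + 1) * g x\<close> is \<open>g x\<close> times the difference of the
integrands on the two sides of the claim, because \<open>\<phi>\<close> solves the Stein equation and the score
is \<open>g' / g\<close>. As \<open>\<Psi>\<close> vanishes at both ends of the interval, the integral of its derivative is 0
(\<open>integral_eq_0_of_vanishing_ends\<close>, \<open>stein_identity_of_density\<close>).

Three points need care.

\<^item> The test function \<open>h\<close> is only measurable, so the Stein equation holds almost everywhere. It
follows from Lebesgue's differentiation theorem for the integral that defines the solution
(\<open>AE_derivative_eq_integrand\<close>, \<open>AE_frechet_stein_equation\<close>). The integrability that this needs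
comes from that of \<open>h(G)\<close>, once the law of \<open>G\<close> is known to have the Frechet density.

\<^item> At finitely many points \<open>g\<close> may fail to be differentiable, or even continuous, so \<open>\<Psi>\<close> could
jump there. It does not: \<open>g\<close> is the derivative of a distribution function, so on each side of
the point it takes values arbitrarily close to its value at the point, while the integrability of
the derivative of \<open>\<Psi>\<close> gives one-sided limits of \<open>\<Psi>\<close>. So both limits are the value
(\<open>isCont_continuous_times_derivative\<close>).

\<^item> The distribution function of \<open>W\<close> is \<open>F(a x + b) ^ n\<close> by independence, and its derivative is
positive exactly where \<open>F\<close> has a positive derivative at \<open>a x + b\<close>
(\<open>pdf_of_affine_power_pos_iff\<close>). This locates the support of \<open>g\<close>.\<close>

section \<open>Differentiation of integrals and integration of derivatives\<close>

text \<open>The Lebesgue differentiation theorem in one dimension. One-sided averages suffice for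
identifying a derivative whose existence is known.\<close>

lemma lebesgue_differentiation_from_right:
  fixes k :: "real \<Rightarrow> real"
  assumes k: "integrable lborel k"
  shows "AE x in lborel. ((\<lambda>s. (LBINT y:{x..x + s}. k y) / s) \<longlongrightarrow> k x) (at_right 0)"
proof -
  have set_int: "set_integrable lborel {c..d} k" for c d
    using integrable_mult_indicator[OF _ k] by (simp add: set_integrable_def)
  have int: "k integrable_on cbox c d" for c d
    using set_borel_integral_eq_integral(1)[OF set_int] by simp
  obtain N where N: "negligible N"
    and lim: "\<And>x e. x \<notin> N \<Longrightarrow> 0 < e \<Longrightarrow> \<exists>d>0. \<forall>s. 0 < s \<and> s < d \<longrightarrow>
       norm (integral (cbox x (x + s *\<^sub>R One)) k /\<^sub>R s ^ DIM(real) - k x) < e"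
    using integrable_ccontinuous_explicit[OF int] by blast
  have "((\<lambda>s. (LBINT y:{x..x + s}. k y) / s) \<longlongrightarrow> k x) (at_right 0)" if "x \<notin> N" for x
  proof (rule tendstoI)
    fix e :: real assume "0 < e"
    from lim[OF that this] obtain d where "d > 0" and d: "\<And>s. 0 < s \<Longrightarrow> s < d \<Longrightarrow>
       norm (integral {x..x + s} k /\<^sub>R s - k x) < e"
      by auto
    have "dist ((LBINT y:{x..x + s}. k y) / s) (k x) < e" if "0 < s" "s < d" for s
      using d[OF that] set_borel_integral_eq_integral(2)[OF set_int]
      by (simp add: dist_real_def divide_inverse mult.commute)
    then show "\<forall>\<^sub>F s in at_right 0. dist ((LBINT y:{x..x + s}. k y) / s) (k x) < e"
      using \<open>d > 0\<close> by (auto simp: eventually_at_right_field)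
  qed
  moreover have "AE x in lborel. x \<notin> N"
    using N AE_not_in negligible_iff_null_sets AE_completion_iff by blast
  ultimately show ?thesis by auto
qed

text \<open>The integrand is merely measurable, so no fundamental theorem for continuous functions
identifies the derivative. A derivative that is known to exist is nevertheless the limit of the
averages of the integrand to the right of the point, and these converge to the integrand almost
everywhere.\<close>

lemma AE_derivative_eq_integrand:
  fixes k I :: "real \<Rightarrow> real"
  assumes k: "integrable lborel k"
    and I: "\<And>x y. A < x \<Longrightarrow> x \<le> y \<Longrightarrow> I y - I x = (LBINT t:{x..y}. k t)"
  shows "AE x in lborel. \<forall>D. A < x \<longrightarrow> (I has_real_derivative D) (at x) \<longrightarrow> D = k x"
  using lebesgue_differentiation_from_right[OF k]
proof eventually_elim
  case (elim x)
  show ?case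
  proof (intro allI impI)
    fix D assume "A < x" and D: "(I has_real_derivative D) (at x)"
    have "((\<lambda>s. (I (x + s) - I x) / s) \<longlongrightarrow> D) (at_right 0)"
      using D unfolding DERIV_def by (rule tendsto_mono[rotated]) (simp add: at_le)
    moreover have "\<forall>\<^sub>F s in at_right 0. (I (x + s) - I x) / s = (LBINT y:{x..x + s}. k y) / s"
      using I[OF \<open>A < x\<close>] by (auto simp: eventually_at_right_field intro!: exI[of _ 1])
    ultimately have "((\<lambda>s. (LBINT y:{x..x + s}. k y) / s) \<longlongrightarrow> D) (at_right 0)"
      by (simp add: tendsto_cong)
    from tendsto_unique[OF trivial_limit_at_right_real this elim] show "D = k x" .
  qed
qed

text \<open>A derivative may be discontinuous, but by the mean value theorem its value at a point is the
limit of its values along some sequence from each side: the difference quotients at \<open>x\<close> are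
values of the derivative at points that converge to \<open>x\<close>. So a one-sided limit of a derivative,
if it exists, can only be the value at the point.\<close>

lemma derivative_approached_from_right:
  fixes H f :: "real \<Rightarrow> real"
  assumes "x < e" and H: "\<And>t. x \<le> t \<Longrightarrow> t < e \<Longrightarrow> (H has_real_derivative f t) (at t)"
  obtains y where "filterlim y (at_right x) sequentially" "(\<lambda>j. f (y j)) \<longlonglongrightarrow> f x"
proof -
  define s where "s j = (e - x) / (real j + 2)" for j
  have s: "0 < s j" "x + s j < e" for j
  proof -
    have "(e - x) / (real j + 2) < (e - x) / 1"
      using \<open>x < e\<close> by (intro divide_strict_left_mono) auto
    then show "0 < s j" "x + s j < e"
      using \<open>x < e\<close> by (auto simp: s_def)
  qed
  have s0: "s \<longlonglongrightarrow> 0" unfolding s_def by real_asymp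
  have "\<exists>y. x < y \<and> y < x + s j \<and> H (x + s j) - H x = s j * f y" for j
    using MVT2[of x "x + s j" H f] s[of j] H by auto
  then obtain y where y: "\<And>j. x < y j" "\<And>j. y j < x + s j"
      and H_y: "\<And>j. H (x + s j) - H x = s j * f (y j)"
    by metis
  have "y \<longlonglongrightarrow> x"
    by (rule tendsto_sandwich[of "\<lambda>_. x" _ _ "\<lambda>j. x + s j"])
       (use y s0 in \<open>auto intro!: eventuallyI less_imp_le tendsto_eq_intros\<close>)
  then have "filterlim y (at_right x) sequentially"
    using y by (auto simp: filterlim_at less_imp_neq[symmetric])
  moreover have "filterlim s (at 0) sequentially"
    using s0 s by (auto simp: filterlim_at less_imp_neq[symmetric] intro!: eventuallyI)
  then have "(\<lambda>j. (H (x + s j) - H x) / s j) \<longlonglongrightarrow> f x"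
    using H[of x] \<open>x < e\<close> unfolding DERIV_def by (auto intro: filterlim_compose)
  then have "(\<lambda>j. f (y j)) \<longlonglongrightarrow> f x"
    using s by (simp add: H_y less_imp_neq[symmetric])
  ultimately show ?thesis by (rule that)
qed

lemma derivative_approached_from_left:
  fixes H f :: "real \<Rightarrow> real"
  assumes "e < x" and H: "\<And>t. e < t \<Longrightarrow> t \<le> x \<Longrightarrow> (H has_real_derivative f t) (at t)"
  obtains y where "filterlim y (at_left x) sequentially" "(\<lambda>j. f (y j)) \<longlonglongrightarrow> f x"
proof -
  have "((\<lambda>t. - H (- t)) has_real_derivative f (- t)) (at t)" if "- x \<le> t" "t < - e" for t
    using that H[of "- t"] by (auto intro!: derivative_eq_intros DERIV_chain'[where f = uminus and g = H])
  then obtain y where "filterlim y (at_right (- x)) sequentially" "(\<lambda>j. f (- y j)) \<longlonglongrightarrow> f x"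
    using derivative_approached_from_right[of "- x" "- e" "\<lambda>t. - H (- t)" "\<lambda>t. f (- t)"] \<open>e < x\<close>
    by auto
  moreover from this(1) have "filterlim (\<lambda>j. - y j) (at_left x) sequentially"
    by (auto simp: at_left_minus[of x] filterlim_def filtermap_filtermap[symmetric] intro: filtermap_mono)
  ultimately show ?thesis
    using that[of "\<lambda>j. - y j"] by simp
qed

lemma has_integral_AE_derivative:
  fixes \<Psi> q :: "real \<Rightarrow> real"
  assumes "c \<le> d" "finite K" and cont: "continuous_on {c..d} \<Psi>"
    and diff: "\<And>x. c < x \<Longrightarrow> x < d \<Longrightarrow> x \<notin> K \<Longrightarrow> \<Psi> differentiable (at x)"
    and q: "AE x in lborel. c < x \<longrightarrow> x < d \<longrightarrow> (\<Psi> has_real_derivative q x) (at x)"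
  shows "(q has_integral (\<Psi> d - \<Psi> c)) {c..d}"
proof -
  obtain N where N: "N \<in> null_sets lborel"
    and q_N: "\<And>x. x \<notin> N \<Longrightarrow> c < x \<Longrightarrow> x < d \<Longrightarrow> (\<Psi> has_real_derivative q x) (at x)"
    using AE_E3[OF q] by auto
  have "(deriv \<Psi> has_integral (\<Psi> d - \<Psi> c)) {c..d}"
    using assms(1-3) diff
    by (intro fundamental_theorem_of_calculus_interior_strong[of K])
       (auto simp: has_real_derivative_iff_has_vector_derivative[symmetric]
             intro: DERIV_deriv_iff_real_differentiable[THEN iffD2])
  moreover have "negligible (N \<union> {c, d})"
    using N by (auto simp: negligible_Un_eq negligible_iff_null_sets null_sets_completionI)
  moreover have "q x = deriv \<Psi> x" if "x \<in> {c..d} - (N \<union> {c, d})" for x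
    using q_N[of x] that by (auto simp: DERIV_imp_deriv)
  ultimately show ?thesis
    by (rule has_integral_spike[rotated, rotated]) auto
qed

text \<open>An integrable derivative forces a finite one-sided limit, because the indefinite integral is
continuous. The value at the point itself is not controlled by this.\<close>

lemma tendsto_at_right_of_integrable_derivative:
  fixes \<Psi> q :: "real \<Rightarrow> real"
  assumes "x < e" and q_int: "q integrable_on {x..e}"
    and diff: "\<And>t. x < t \<Longrightarrow> t \<le> e \<Longrightarrow> \<Psi> differentiable (at t)"
    and q: "AE t in lborel. x < t \<longrightarrow> t < e \<longrightarrow> (\<Psi> has_real_derivative q t) (at t)"
  shows "(\<Psi> \<longlongrightarrow> \<Psi> e - integral {x..e} q) (at_right x)"
proof -
  have "\<Psi> e - integral {t..e} q = \<Psi> t" if t: "x < t" "t < e" for t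
  proof -
    have "(q has_integral (\<Psi> e - \<Psi> t)) {t..e}"
      using t diff q
      by (intro has_integral_AE_derivative[of t e "{}"])
         (auto intro!: continuous_at_imp_continuous_on differentiable_imp_continuous_within)
    then show ?thesis by (simp add: integral_unique)
  qed
  then have "\<forall>\<^sub>F t in at_right x. \<Psi> e - integral {t..e} q = \<Psi> t"
    using \<open>x < e\<close> by (auto simp: eventually_at_right_field)
  moreover have "continuous_on {x..e} (\<lambda>t. integral {t..e} q)"
    by (rule indefinite_integral_continuous_1'[OF q_int])
  then have "((\<lambda>t. integral {t..e} q) \<longlongrightarrow> integral {x..e} q) (at_right x)"
    using \<open>x < e\<close> by (rule continuous_on_Icc_at_rightD)
  then have "((\<lambda>t. \<Psi> e - integral {t..e} q) \<longlongrightarrow> \<Psi> e - integral {x..e} q) (at_right x)"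
    by (intro tendsto_intros)
  ultimately show ?thesis by (simp add: tendsto_cong)
qed

lemma tendsto_at_left_of_integrable_derivative:
  fixes \<Psi> q :: "real \<Rightarrow> real"
  assumes "e < x" and q_int: "q integrable_on {e..x}"
    and diff: "\<And>t. e \<le> t \<Longrightarrow> t < x \<Longrightarrow> \<Psi> differentiable (at t)"
    and q: "AE t in lborel. e < t \<longrightarrow> t < x \<longrightarrow> (\<Psi> has_real_derivative q t) (at t)"
  shows "(\<Psi> \<longlongrightarrow> \<Psi> e + integral {e..x} q) (at_left x)"
proof -
  have "\<Psi> e + integral {e..t} q = \<Psi> t" if t: "e < t" "t < x" for t
  proof -
    have "(q has_integral (\<Psi> t - \<Psi> e)) {e..t}"
      using t diff q
      by (intro has_integral_AE_derivative[of e t "{}"])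
         (auto intro!: continuous_at_imp_continuous_on differentiable_imp_continuous_within)
    then show ?thesis by (simp add: integral_unique)
  qed
  then have "\<forall>\<^sub>F t in at_left x. \<Psi> e + integral {e..t} q = \<Psi> t"
    using \<open>e < x\<close> by (auto simp: eventually_at_left_field)
  moreover have "continuous_on {e..x} (\<lambda>t. integral {e..t} q)"
    by (rule indefinite_integral_continuous_1[OF q_int])
  then have "((\<lambda>t. integral {e..t} q) \<longlongrightarrow> integral {e..x} q) (at_left x)"
    using \<open>e < x\<close> by (rule continuous_on_Icc_at_leftD)
  then have "((\<lambda>t. \<Psi> e + integral {e..t} q) \<longlongrightarrow> \<Psi> e + integral {e..x} q) (at_left x)"
    by (intro tendsto_intros)
  ultimately show ?thesis by (simp add: tendsto_cong)
qed

text \<open>This removes the exceptional points of \<open>g\<close>. Let \<open>w\<close> be continuous at \<open>x\<close> and \<open>g\<close> a derivative. The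
product may be non-differentiable at \<open>x\<close>, and \<open>g\<close> may even oscillate or be unbounded near \<open>x\<close>.
But the integrability of the derivative of the product near \<open>x\<close> gives both one-sided limits of
the product, and the sequences along which \<open>g\<close> tends to \<open>g x\<close> show that these limits are
\<open>w x * g x\<close>.\<close>

lemma isCont_continuous_times_derivative:
  fixes w g H q :: "real \<Rightarrow> real"
  assumes "c < x" "x < d" "finite K"
    and w: "isCont w x"
    and H: "\<And>t. c < t \<Longrightarrow> t < d \<Longrightarrow> (H has_real_derivative g t) (at t)"
    and q_int: "q integrable_on {c..d}"
    and diff: "\<And>t. c < t \<Longrightarrow> t < d \<Longrightarrow> t \<notin> K \<Longrightarrow> (\<lambda>t. w t * g t) differentiable (at t)"
    and q: "AE t in lborel. c < t \<longrightarrow> t < d \<longrightarrow> ((\<lambda>t. w t * g t) has_real_derivative q t) (at t)"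
  shows "isCont (\<lambda>t. w t * g t) x"
proof -
  let ?\<Psi> = "\<lambda>t. w t * g t"
  obtain \<delta> where "\<delta> > 0" and K: "\<And>t. t \<in> K \<Longrightarrow> t \<noteq> x \<Longrightarrow> \<delta> \<le> dist x t"
    using finite_set_avoid[OF \<open>finite K\<close>, of x] by auto
  \<comment> \<open>A radius such that \<open>x\<close> is the only possible exceptional point in \<open>[x - r, x + r]\<close>.\<close>
  define r where "r = Min {\<delta>, x - c, d - x} / 2"
  have r: "0 < r" "r < \<delta>" "c < x - r" "x + r < d"
    using \<open>\<delta> > 0\<close> assms(1,2) by (auto simp: r_def min_def field_simps)
  have diff': "?\<Psi> differentiable (at t)" if "t \<noteq> x" "x - r \<le> t" "t \<le> x + r" for t
    using that r K[of t] by (intro diff) (auto simp: dist_real_def)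
  have w_lim: "(w \<longlongrightarrow> w x) (at_right x)" "(w \<longlongrightarrow> w x) (at_left x)"
    using w by (auto simp: continuous_at intro: tendsto_mono[OF at_le])
  obtain y where y: "filterlim y (at_right x) sequentially" "(\<lambda>j. g (y j)) \<longlonglongrightarrow> g x"
    using derivative_approached_from_right[of x d H g] H assms(1,2) by auto
  have lim_right: "(?\<Psi> \<longlongrightarrow> ?\<Psi> (x + r) - integral {x..x + r} q) (at_right x)"
    using r diff' q
    by (intro tendsto_at_right_of_integrable_derivative)
       (auto intro: integrable_subinterval_real[OF q_int] elim!: eventually_mono)
  have "?\<Psi> (x + r) - integral {x..x + r} q = ?\<Psi> x"
    using filterlim_compose[OF lim_right y(1)]
      tendsto_mult[OF filterlim_compose[OF w_lim(1) y(1)] y(2)]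
    by (rule LIMSEQ_unique)
  moreover obtain z where z: "filterlim z (at_left x) sequentially" "(\<lambda>j. g (z j)) \<longlonglongrightarrow> g x"
    using derivative_approached_from_left[of c x H g] H assms(1,2) by auto
  have lim_left: "(?\<Psi> \<longlongrightarrow> ?\<Psi> (x - r) + integral {x - r..x} q) (at_left x)"
    using r diff' q
    by (intro tendsto_at_left_of_integrable_derivative)
       (auto intro: integrable_subinterval_real[OF q_int] elim!: eventually_mono)
  have "?\<Psi> (x - r) + integral {x - r..x} q = ?\<Psi> x"
    using filterlim_compose[OF lim_left z(1)]
      tendsto_mult[OF filterlim_compose[OF w_lim(2) z(1)] z(2)]
    by (rule LIMSEQ_unique)
  ultimately show ?thesis
    using lim_right lim_left by (simp add: continuous_at filterlim_split_at)
qed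

text \<open>The product \<open>w * g\<close> is continuous across the exceptional points, so the fundamental theorem of
calculus holds on every compact subinterval. Exhausting \<open>(l, u)\<close> by such intervals, the boundary
terms vanish in the limit.\<close>

lemma integral_eq_0_of_vanishing_ends:
  fixes w g H q :: "real \<Rightarrow> real" and l u :: ereal
  assumes "l < u" "finite K" and q_int: "integrable lborel q"
    and w: "\<And>x. l < ereal x \<Longrightarrow> ereal x < u \<Longrightarrow> isCont w x"
    and H: "\<And>x. l < ereal x \<Longrightarrow> ereal x < u \<Longrightarrow> (H has_real_derivative g x) (at x)"
    and diff: "\<And>x. l < ereal x \<Longrightarrow> ereal x < u \<Longrightarrow> x \<notin> K \<Longrightarrow> (\<lambda>x. w x * g x) differentiable (at x)"
    and q: "AE x in lborel. l < ereal x \<longrightarrow> ereal x < u \<longrightarrow>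
              ((\<lambda>x. w x * g x) has_real_derivative q x) (at x)"
    and lim_l: "(((\<lambda>x. w x * g x) \<circ> real_of_ereal) \<longlongrightarrow> 0) (at_right l)"
    and lim_u: "(((\<lambda>x. w x * g x) \<circ> real_of_ereal) \<longlongrightarrow> 0) (at_left u)"
  shows "(LBINT x:einterval l u. q x) = 0"
proof -
  let ?\<Psi> = "\<lambda>x. w x * g x"
  have set_int: "set_integrable lborel A q" if "A \<in> sets borel" for A
    using integrable_mult_indicator[OF _ q_int, of A] that by (simp add: set_integrable_def)
  obtain c d :: "nat \<Rightarrow> real" where
    union: "einterval l u = (\<Union>i. {c i .. d i})" and mono: "incseq d" "decseq c"
    and cd: "\<And>i. c i < d i" "\<And>i. l < c i" "\<And>i. d i < u"
    and lim: "(\<lambda>i. ereal (c i)) \<longlonglongrightarrow> l" "(\<lambda>i. ereal (d i)) \<longlonglongrightarrow> u"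
    by (rule einterval_Icc_approximation[OF \<open>l < u\<close>]) blast
  have FTC: "(LBINT x:{c i..d i}. q x) = ?\<Psi> (d i) - ?\<Psi> (c i)" for i
  proof -
    have inside: "l < ereal x" "ereal x < u" if "c i \<le> x" "x \<le> d i" for x
      using that cd[of i] by (meson ereal_less_eq(3) less_le_trans le_less_trans)+
    have cont: "isCont ?\<Psi> x" if x: "l < ereal x" "ereal x < u" for x
    proof -
      obtain c' where c': "l < ereal c'" "c' < x" using ereal_dense2[OF x(1)] by auto
      obtain d' where d': "x < d'" "ereal d' < u" using ereal_dense2[OF x(2)] by auto
      have inside': "l < ereal t" "ereal t < u" if "c' < t" "t < d'" for t
        using that c'(1) d'(2) by (meson ereal_less(1) less_ereal.simps(1) less_trans)+
      show ?thesis
        using c' d' w[OF x] H diff inside' \<open>finite K\<close> q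
          set_borel_integral_eq_integral(1)[OF set_int, of "{c'..d'}"]
        by (intro isCont_continuous_times_derivative[of c' x d' K w H g q])
           (auto elim!: eventually_mono)
    qed
    have "(q has_integral (?\<Psi> (d i) - ?\<Psi> (c i))) {c i..d i}"
      using cd(1)[of i] \<open>finite K\<close> inside cont diff q
      by (intro has_integral_AE_derivative[of _ _ K])
         (auto intro!: continuous_at_imp_continuous_on elim!: eventually_mono)
    then show ?thesis
      by (simp add: set_borel_integral_eq_integral(2)[OF set_int] integral_unique)
  qed
  have "(\<lambda>i. LBINT x:{c i..d i}. q x) \<longlonglongrightarrow> (LBINT x:(\<Union>i. {c i..d i}). q x)"
  proof (intro set_integral_cont_up set_int)
    show "incseq (\<lambda>i. {c i..d i})"
      using mono by (auto simp: monotone_def intro!: order_trans)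
  qed auto
  moreover have "(\<lambda>i. (?\<Psi> \<circ> real_of_ereal) (ereal (d i)) - (?\<Psi> \<circ> real_of_ereal) (ereal (c i))) \<longlonglongrightarrow> 0 - 0"
    using lim cd
    by (intro tendsto_diff filterlim_compose[OF lim_l] filterlim_compose[OF lim_u])
       (auto simp: filterlim_at less_imp_neq less_imp_neq[symmetric] intro!: always_eventually)
  ultimately show ?thesis
    by (auto simp: FTC union dest: LIMSEQ_unique)
qed

section \<open>The Frechet law and its Stein equation\<close>

definition frechet_density :: "real \<Rightarrow> real \<Rightarrow> real" where
  "frechet_density \<alpha> x = (if 0 < x then \<alpha> * x powr (- \<alpha> - 1) * exp (- (x powr (- \<alpha>))) else 0)"

lemma borel_measurable_frechet_density [measurable]:
  "frechet_density \<alpha> \<in> borel_measurable borel"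
  unfolding frechet_density_def by measurable

lemma frechet_density_nonneg: "0 < \<alpha> \<Longrightarrow> 0 \<le> frechet_density \<alpha> x"
  by (simp add: frechet_density_def)

text \<open>At the origin the left side is constant, and on the right \<open>exp (- s powr (- \<alpha>))\<close> vanishes faster
than any power of \<open>s\<close>. Including the origin spares a limiting argument for the integral of the
density over \<open>[0, x]\<close>.\<close>

lemma has_real_derivative_frechet_cdf:
  assumes "0 < \<alpha>"
  shows "(frechet_cdf \<alpha> has_real_derivative frechet_density \<alpha> x) (at x)"
proof -
  consider "0 < x" | "x < 0" | "x = 0" by linarith
  then show ?thesis
  proof cases
    case 1
    have "((\<lambda>x. exp (- (x powr (- \<alpha>)))) has_real_derivative frechet_density \<alpha> x) (at x)"
      using 1 by (auto intro!: derivative_eq_intros simp: frechet_density_def)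
    then show ?thesis
      by (rule has_field_derivative_transform_within_open[of _ _ _ "{0<..}"])
         (use 1 in \<open>auto simp: frechet_cdf_def\<close>)
  next
    case 2
    have "((\<lambda>x. 0) has_real_derivative frechet_density \<alpha> x) (at x)"
      using 2 by (simp add: frechet_density_def)
    then show ?thesis
      by (rule has_field_derivative_transform_within_open[of _ _ _ "{..<0}"])
         (use 2 in \<open>auto simp: frechet_cdf_def\<close>)
  next
    case 3
    have "((\<lambda>s. exp (- (s powr (- \<alpha>))) / s) \<longlongrightarrow> 0) (at_right 0)"
      using assms by real_asymp
    then have "((\<lambda>s. frechet_cdf \<alpha> s / s) \<longlongrightarrow> 0) (at_right 0)"
      by (rule Lim_transform_eventually) (auto simp: frechet_cdf_def eventually_at_right_field intro: exI[of _ 1])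
    moreover have "((\<lambda>s. frechet_cdf \<alpha> s / s) \<longlongrightarrow> 0) (at_left 0)"
      by (rule tendsto_eventually) (auto simp: frechet_cdf_def eventually_at_left_field intro: exI[of _ "-1"])
    ultimately have "((\<lambda>s. frechet_cdf \<alpha> s / s) \<longlongrightarrow> 0) (at 0)"
      by (simp add: filterlim_split_at)
    then show ?thesis
      using 3 by (simp add: DERIV_def frechet_cdf_def frechet_density_def)
  qed
qed

lemma frechet_cdf_tendsto_1:
  assumes "0 < \<alpha>" shows "(frechet_cdf \<alpha> \<longlongrightarrow> 1) at_top"
proof -
  have "((\<lambda>x. exp (- (x powr (- \<alpha>)))) \<longlongrightarrow> 1) at_top"
    using assms by real_asymp
  then show ?thesis
    by (rule Lim_transform_eventually) (use eventually_gt_at_top[of 0] in \<open>auto simp: frechet_cdf_def elim!: eventually_mono\<close>)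
qed

lemma distributed_frechet:
  assumes "0 < \<alpha>" "prob_space N" "G \<in> borel_measurable N"
    and cdf: "cdf (distr N borel G) = frechet_cdf \<alpha>"
  shows "distributed N lborel G (\<lambda>x. ennreal (frechet_density \<alpha> x))"
proof -
  let ?g = "frechet_density \<alpha>" and ?D = "density lborel (\<lambda>x. ennreal (frechet_density \<alpha> x))"
  have "emeasure ?D UNIV = (\<integral>\<^sup>+x. ennreal (?g x) * indicator {0..} x \<partial>lborel)"
    by (auto simp: emeasure_density frechet_density_def intro!: nn_integral_cong split: split_indicator)
  also have "\<dots> = ennreal (1 - frechet_cdf \<alpha> 0)"
    using assms(1) by (intro nn_integral_FTC_atLeast has_real_derivative_frechet_cdf
      frechet_density_nonneg frechet_cdf_tendsto_1) auto
  finally interpret D: prob_space ?D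
    by (intro prob_spaceI) (simp add: frechet_cdf_def)
  have "emeasure ?D {..x} = ennreal (frechet_cdf \<alpha> x)" for x
  proof (cases "0 \<le> x")
    case True
    have "emeasure ?D {..x} = (\<integral>\<^sup>+y. ennreal (?g y) * indicator {0..x} y \<partial>lborel)"
      by (auto simp: emeasure_density frechet_density_def intro!: nn_integral_cong split: split_indicator)
    also have "\<dots> = ennreal (frechet_cdf \<alpha> x - frechet_cdf \<alpha> 0)"
      using assms(1) True by (intro nn_integral_FTC_Icc has_real_derivative_frechet_cdf
        frechet_density_nonneg) auto
    finally show ?thesis by (simp add: frechet_cdf_def)
  next
    case False
    have "emeasure ?D {..x} = (\<integral>\<^sup>+y. 0 \<partial>(lborel :: real measure))"
      unfolding emeasure_density[of "\<lambda>x. ennreal (?g x)" lborel "{..x}", simplified]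
      using False
      by (intro nn_integral_cong) (auto simp: frechet_density_def split: split_indicator)
    then show ?thesis using False by (simp add: frechet_cdf_def)
  qed
  then have "cdf ?D = frechet_cdf \<alpha>"
    by (auto simp: cdf_def measure_def frechet_cdf_def)
  moreover have "real_distribution (distr N borel G)"
    using assms by (intro prob_space.real_distribution_distr) auto
  moreover have "real_distribution ?D"
    by unfold_locales auto
  ultimately have "distr N borel G = ?D"
    using cdf by (intro cdf_unique) auto
  moreover have "distr N lborel G = distr N borel G"
    by (rule distr_cong) auto
  ultimately show ?thesis
    using assms by (auto simp: distributed_def)
qed

text \<open>Up to the factor \<open>exp (- x powr (- \<alpha>))\<close>, the Stein solution is an indefinite integral of
\<open>(h - m)\<close> against the Frechet density divided by \<open>\<alpha>\<close>. Since \<open>h\<close> need not be continuous, the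
Stein equation holds only almost everywhere, which is all that integration against a density
sees.\<close>

lemma AE_frechet_stein_equation:
  assumes \<alpha>: "0 < \<alpha>"
    and h: "integrable lborel (\<lambda>x. frechet_density \<alpha> x * h x)"
    and density: "integrable lborel (frechet_density \<alpha>)"
    and \<phi>: "\<And>x. 0 < x \<Longrightarrow> \<phi> x = frechet_stein \<alpha> m h x"
    and diff: "\<And>x. 0 < x \<Longrightarrow> \<phi> differentiable (at x)"
  shows "AE x in lborel. 0 < x \<longrightarrow> deriv \<phi> x * x powr (\<alpha> + 1) + \<alpha> * \<phi> x = h x - m"
proof -
  define k where "k x = frechet_density \<alpha> x * (h x - m) / \<alpha>" for x
  \<comment> \<open>Integrating from \<open>-\<infinity>\<close> instead of 0 changes nothing, as \<open>k\<close> vanishes on the negative axis.\<close>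
  define I where "I x = (LBINT y:{..x}. k y)" for x
  have k: "integrable lborel k"
    using h density by (simp add: k_def[abs_def] algebra_simps)
  have set_int: "set_integrable lborel A k" if "A \<in> sets borel" for A
    using integrable_mult_indicator[OF _ k, of A] that by (simp add: set_integrable_def)
  have "I y - I x = (LBINT t:{x..y}. k t)" if "x \<le> y" for x y
  proof -
    have "I y = (LBINT t:{..x} \<union> {x<..y}. k t)"
      using that unfolding I_def by (simp add: ivl_disj_un)
    also have "\<dots> = I x + (LBINT t:{x<..y}. k t)"
      unfolding I_def by (intro set_integral_Un set_int) auto
    also have "(LBINT t:{x<..y}. k t) = (LBINT t:{x..y}. k t)"
      unfolding set_lebesgue_integral_def using AE_lborel_singleton[of x]
      using set_int[of "{x<..y}"] set_int[of "{x..y}"]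
      by (intro integral_cong_AE) (auto simp: set_integrable_def elim!: eventually_mono split: split_indicator)
    finally show ?thesis by simp
  qed
  then have "AE x in lborel. \<forall>D. 0 < x \<longrightarrow> (I has_real_derivative D) (at x) \<longrightarrow> D = k x"
    by (intro AE_derivative_eq_integrand[OF k]) auto
  then show ?thesis
  proof eventually_elim
    case (elim x)
    show ?case
    proof
      assume x: "0 < x"
      have I: "exp (- (y powr (- \<alpha>))) * \<phi> y = I y" if "0 < y" for y
      proof -
        have "(LBINT t:{0..y}. (h t - m) * t powr (- \<alpha> - 1) * exp (- (t powr (- \<alpha>)))) = I y"
          unfolding set_lebesgue_integral_def I_def
          using \<alpha> by (intro Bochner_Integration.integral_cong)
            (auto simp: k_def frechet_density_def split: split_indicator)
        then show ?thesis
          using that by (simp add: \<phi> frechet_stein_def exp_minus field_simps)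
      qed
      have \<phi>': "(\<phi> has_real_derivative deriv \<phi> x) (at x)"
        using diff[OF x] by (simp add: DERIV_deriv_iff_real_differentiable)
      have "((\<lambda>y. exp (- (y powr (- \<alpha>))) * \<phi> y) has_real_derivative
              exp (- (x powr (- \<alpha>))) * (\<alpha> * x powr (- \<alpha> - 1) * \<phi> x + deriv \<phi> x)) (at x)"
        using x by (auto intro!: derivative_eq_intros \<phi>' simp: algebra_simps)
      then have "(I has_real_derivative
              exp (- (x powr (- \<alpha>))) * (\<alpha> * x powr (- \<alpha> - 1) * \<phi> x + deriv \<phi> x)) (at x)"
        by (rule has_field_derivative_transform_within_open[of _ _ _ "{0<..}"]) (use x I in auto)
      with elim x have "exp (- (x powr (- \<alpha>))) * (\<alpha> * x powr (- \<alpha> - 1) * \<phi> x + deriv \<phi> x) = k x"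
        by blast
      also have "k x = exp (- (x powr (- \<alpha>))) * (x powr (- \<alpha> - 1) * (h x - m))"
        using x \<alpha> by (simp add: k_def frechet_density_def)
      finally have "\<alpha> * x powr (- \<alpha> - 1) * \<phi> x + deriv \<phi> x = x powr (- \<alpha> - 1) * (h x - m)"
        by simp
      then have "x powr (\<alpha> + 1) * (\<alpha> * x powr (- \<alpha> - 1) * \<phi> x + deriv \<phi> x)
          = x powr (\<alpha> + 1) * (x powr (- \<alpha> - 1) * (h x - m))"
        by simp
      moreover have "x powr (\<alpha> + 1) * x powr (- \<alpha> - 1) = 1"
        using x by (simp add: powr_add[symmetric])
      ultimately show "deriv \<phi> x * x powr (\<alpha> + 1) + \<alpha> * \<phi> x = h x - m"
        by algebra
    qed
  qed
qed

section \<open>Integration by parts against a density\<close>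

text \<open>On the open set the derivative is the pointwise limit of difference quotients. The indicator
hides the points where \<open>deriv\<close> has an unspecified value.\<close>

lemma borel_measurable_deriv_on_open:
  fixes g :: "real \<Rightarrow> real"
  assumes [measurable]: "g \<in> borel_measurable borel" and "open A"
    and diff: "\<And>x. x \<in> A \<Longrightarrow> g differentiable (at x)"
  shows "(\<lambda>x. indicator A x * deriv g x) \<in> borel_measurable borel"
proof (rule borel_measurable_LIMSEQ_real)
  have [measurable]: "A \<in> sets borel" using \<open>open A\<close> by simp
  show "(\<lambda>x. indicator A x * ((g (x + 1 / real (Suc j)) - g x) / (1 / real (Suc j))))
      \<in> borel_measurable borel" for j
    by measurable
  fix x
  have "filterlim (\<lambda>j. 1 / real (Suc j)) (at 0) sequentially"
    using LIMSEQ_inverse_real_of_nat by (auto simp: filterlim_at inverse_eq_divide)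
  then show "(\<lambda>j. indicator A x * ((g (x + 1 / real (Suc j)) - g x) / (1 / real (Suc j))))
      \<longlonglongrightarrow> indicator A x * deriv g x"
  proof (cases "x \<in> A")
    case True
    then have "((\<lambda>s. (g (x + s) - g x) / s) \<longlongrightarrow> deriv g x) (at 0)"
      using diff[OF True] by (simp add: DERIV_deriv_iff_real_differentiable[symmetric] DERIV_def)
    with \<open>filterlim _ (at 0) sequentially\<close> show ?thesis
      by (intro tendsto_mult tendsto_const) (rule filterlim_compose)
  qed simp
qed

lemma score_eq:
  assumes "g differentiable (at x)" "0 < g x"
  shows "score g x = deriv g x / g x"
proof -
  have "(g has_real_derivative deriv g x) (at x)"
    using assms(1) by (simp add: DERIV_deriv_iff_real_differentiable)
  then have "((\<lambda>y. ln (g y)) has_real_derivative deriv g x / g x) (at x)"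
    using assms(2) by (auto intro!: derivative_eq_intros)
  then show ?thesis by (simp add: score_def DERIV_imp_deriv)
qed

text \<open>The function \<open>\<Psi> x = \<phi> x * x powr (\<alpha> + 1) * g x\<close> tends to 0 at both ends of the support, and
almost everywhere on the support its derivative is
\<open>g x * (h x - m - \<alpha> * \<phi> x * (1 - x powr \<alpha> * ((\<alpha> + 1) / \<alpha> + x / \<alpha> * score g x)))\<close>,
by the Stein equation and \<open>score g = g' / g\<close>. The integral of this derivative is 0, and this is
the identity written as an integral against the density.

The function \<open>\<psi>\<close> that appears in the conclusion agrees with \<open>\<phi>\<close> only on the positive axis. Under
the law of \<open>W\<close> the difference is invisible.\<close>

lemma stein_identity_of_density:
  fixes g H h \<phi> \<psi> :: "real \<Rightarrow> real" and l u :: ereal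
  assumes \<alpha>: "0 < \<alpha>" and M: "prob_space M"
    and W: "distributed M lborel W (\<lambda>x. ennreal (g x))" and g_nonneg: "\<And>x. 0 \<le> g x"
    and "0 \<le> l" "l < u" "finite K"
    and H: "\<And>x. x \<in> einterval l u \<Longrightarrow> (H has_real_derivative g x) (at x)"
    and pos: "\<And>x. x \<in> einterval l u \<Longrightarrow> 0 < g x"
    and outside: "AE x in lborel. x \<notin> einterval l u \<longrightarrow> g x = 0"
    and diff: "\<And>x. x \<in> einterval l u \<Longrightarrow> x \<notin> K \<Longrightarrow> g differentiable (at x)"
    and \<phi>: "\<phi> \<in> stein_class \<alpha> g l u"
    and stein: "AE x in lborel. 0 < x \<longrightarrow> deriv \<phi> x * x powr (\<alpha> + 1) + \<alpha> * \<phi> x = h x - m"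
    and h: "h \<in> borel_measurable borel"
    and h_W: "integrable M (\<lambda>\<omega>. h (W \<omega>))"
    and \<psi>: "\<And>x. 0 < x \<Longrightarrow> \<phi> x = \<psi> x"
    and rhs_W: "integrable M (\<lambda>\<omega>. \<psi> (W \<omega>) *
          (1 - W \<omega> powr \<alpha> * ((\<alpha> + 1) / \<alpha> + W \<omega> / \<alpha> * score g (W \<omega>))))"
  shows "(\<integral>\<omega>. h (W \<omega>) \<partial>M) - m =
    \<alpha> * (\<integral>\<omega>. \<psi> (W \<omega>) *
          (1 - W \<omega> powr \<alpha> * ((\<alpha> + 1) / \<alpha> + W \<omega> / \<alpha> * score g (W \<omega>))) \<partial>M)"
proof -
  interpret prob_space M by (rule M)
  define A where "A = einterval l u - K"
  define R where "R x = \<psi> x * (1 - x powr \<alpha> * ((\<alpha> + 1) / \<alpha> + x / \<alpha> * score g x))" for x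
  \<comment> \<open>\<open>R\<close> involves \<open>\<psi>\<close> and \<open>score g\<close>, which are arbitrary off \<open>A\<close>; \<open>r\<close> is a Borel version of it.\<close>
  define r where "r x = indicator A x * (\<phi> x * (1 - x powr \<alpha> *
      ((\<alpha> + 1) / \<alpha> + x / \<alpha> * (indicator A x * deriv g x / g x))))" for x
  define q where "q x = g x * (h x - m - \<alpha> * r x)" for x
  have "open A"
    unfolding A_def using \<open>finite K\<close> by (intro open_Diff open_einterval finite_imp_closed)
  then have [measurable]: "A \<in> sets borel" by simp
  have A: "x \<in> einterval l u" "0 < x" "x \<notin> K" "0 < g x" "g differentiable (at x)" if "x \<in> A" for x
  proof -
    show x: "x \<in> einterval l u" "x \<notin> K" using that by (auto simp: A_def)
    then have "0 < ereal x"
      using le_less_trans[OF \<open>0 \<le> l\<close>, of "ereal x"] by (simp add: einterval_iff)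
    then show "0 < x" by simp
    show "0 < g x" "g differentiable (at x)" using pos diff x by auto
  qed
  have r_A: "r x = R x" if "x \<in> A" for x
    using A[OF that] that by (simp add: r_def R_def score_eq \<psi>)
  have K_null: "AE x in lborel. x \<notin> K"
    using \<open>finite K\<close> by (intro AE_not_in finite_imp_null_set_lborel)
  have W_meas [measurable]: "W \<in> borel_measurable M"
    using distributed_measurable[OF W] by simp
  have g [measurable]: "g \<in> borel_measurable borel"
    using distributed_real_measurable[OF _ W] g_nonneg by simp
  have \<phi>_diff: "\<phi> differentiable (at x)" for x
    using \<phi> by (auto simp: stein_class_def differentiable_on_def)
  then have "continuous_on UNIV \<phi>"
    by (auto intro!: continuous_at_imp_continuous_on differentiable_imp_continuous_within)
  then have [measurable]: "\<phi> \<in> borel_measurable borel"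
    by (rule borel_measurable_continuous_onI)
  have [measurable]: "(\<lambda>x. indicator A x * deriv g x) \<in> borel_measurable borel"
    using A(5) by (intro borel_measurable_deriv_on_open \<open>open A\<close> g)
  have r [measurable]: "r \<in> borel_measurable borel"
    unfolding r_def[abs_def] by measurable
  note [measurable] = h
  have "AE x in lborel. 0 < ennreal (g x) \<longrightarrow> x \<in> A"
    using outside K_null by eventually_elim (auto simp: A_def)
  then have "AE x in distr M lborel W. x \<in> A"
    unfolding distributed_distr_eq_density[OF W] by (subst AE_density) auto
  then have W_A: "AE \<omega> in M. W \<omega> \<in> A"
    by (rule AE_distrD[rotated]) simp
  then have r_R: "AE \<omega> in M. r (W \<omega>) = R (W \<omega>)"
    by eventually_elim (rule r_A)
  have R_W: "integrable M (\<lambda>\<omega>. R (W \<omega>))"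
    using rhs_W by (simp add: R_def)
  then have r_W: "integrable M (\<lambda>\<omega>. r (W \<omega>))"
    by (rule integrable_cong_AE_imp) (use r_R in auto)
  have int_W: "integrable M (\<lambda>\<omega>. h (W \<omega>) - m - \<alpha> * r (W \<omega>))"
    using h_W r_W by auto
  have q: "integrable lborel q"
    unfolding q_def[abs_def]
    using distributed_integrable[OF W, of "\<lambda>x. h x - m - \<alpha> * r x"] int_W g_nonneg by simp
  have q_outside: "AE x in lborel. q x = indicator (einterval l u) x *\<^sub>R q x"
    using outside by eventually_elim (auto simp: q_def split: split_indicator)
  let ?\<Psi> = "\<lambda>x. (\<phi> x * x powr (\<alpha> + 1)) * g x"
  have \<Psi>': "(?\<Psi> has_real_derivative
      (deriv \<phi> x * x powr (\<alpha> + 1) + (\<alpha> + 1) * x powr \<alpha> * \<phi> x) * g x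
       + deriv g x * (\<phi> x * x powr (\<alpha> + 1))) (at x)" if "x \<in> A" for x
  proof -
    have "(\<phi> has_real_derivative deriv \<phi> x) (at x)" "(g has_real_derivative deriv g x) (at x)"
      using \<phi>_diff A[OF that] by (simp_all add: DERIV_deriv_iff_real_differentiable)
    then show ?thesis
      using A[OF that] by (auto intro!: derivative_eq_intros simp: algebra_simps)
  qed
  have "(LBINT x:einterval l u. q x) = 0"
  proof (rule integral_eq_0_of_vanishing_ends[where w = "\<lambda>x. \<phi> x * x powr (\<alpha> + 1)" and g = g and H = H])
    show "isCont (\<lambda>x. \<phi> x * x powr (\<alpha> + 1)) x" if "l < ereal x" "ereal x < u" for x
    proof -
      have "0 < ereal x" using \<open>0 \<le> l\<close> that(1) by (rule le_less_trans)
      moreover have "isCont \<phi> x"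
        by (rule differentiable_imp_continuous_within[OF \<phi>_diff])
      ultimately show ?thesis
        by (auto intro!: continuous_intros)
    qed
    show "?\<Psi> differentiable (at x)" if "l < ereal x" "ereal x < u" "x \<notin> K" for x
      using \<Psi>'[of x] that by (auto simp: A_def einterval_iff real_differentiable_def)
    show "AE x in lborel. l < ereal x \<longrightarrow> ereal x < u \<longrightarrow> (?\<Psi> has_real_derivative q x) (at x)"
      using stein K_null
    proof eventually_elim
      case (elim x)
      show ?case
      proof (intro impI)
        assume "l < ereal x" "ereal x < u"
        with elim have x: "x \<in> A" by (simp add: A_def einterval_iff)
        have powr_Suc: "x powr (\<alpha> + 1) = x powr \<alpha> * x"
          using A(2)[OF x] by (simp add: powr_add)
        have h_eq: "h x = deriv \<phi> x * (x powr \<alpha> * x) + \<alpha> * \<phi> x + m"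
          using elim A(2)[OF x] by (simp add: powr_Suc)
        have "q x = (deriv \<phi> x * x powr (\<alpha> + 1) + (\<alpha> + 1) * x powr \<alpha> * \<phi> x) * g x
            + deriv g x * (\<phi> x * x powr (\<alpha> + 1))"
          unfolding q_def h_eq powr_Suc
          using \<alpha> A(4)[OF x] x by (simp add: r_def field_simps)
        with \<Psi>'[OF x] show "(?\<Psi> has_real_derivative q x) (at x)" by simp
      qed
    qed
  qed (use assms q in \<open>auto simp: einterval_iff stein_class_def\<close>)
  then have "(\<integral>x. q x \<partial>lborel) = 0"
    unfolding set_lebesgue_integral_def
    using integral_cong_AE[OF _ _ q_outside] q by auto
  moreover have "(\<integral>x. q x \<partial>lborel) = (\<integral>\<omega>. h (W \<omega>) - m - \<alpha> * r (W \<omega>) \<partial>M)"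
    unfolding q_def by (rule distributed_integral[OF W]) (use g_nonneg in auto)
  moreover have "\<dots> = (\<integral>\<omega>. h (W \<omega>) \<partial>M) - m - \<alpha> * (\<integral>\<omega>. r (W \<omega>) \<partial>M)"
    using h_W r_W by (simp add: prob_space)
  moreover have "(\<integral>\<omega>. r (W \<omega>) \<partial>M) = (\<integral>\<omega>. R (W \<omega>) \<partial>M)"
    using r_R R_W by (intro integral_cong_AE) auto
  ultimately show ?thesis
    by (simp add: R_def)
qed

section \<open>The law of the renormalized maximum\<close>

lemma cdf_renorm_max:
  assumes M: "prob_space M"
    and indep: "prob_space.indep_vars M (\<lambda>_. borel) X {1..}"
    and ident: "\<And>i. 1 \<le> i \<Longrightarrow> cdf (distr M borel (X i)) = F"
    and "1 \<le> n" "0 < a n"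
    and W: "renorm_max X a b n \<in> borel_measurable M"
  shows "cdf (distr M borel (renorm_max X a b n)) x = F (a n * x + b n) ^ n"
proof -
  interpret prob_space M by (rule M)
  let ?t = "a n * x + b n"
  have X: "X i \<in> borel_measurable M" if "1 \<le> i" for i
    using indep that by (auto simp: indep_vars_def)
  have "renorm_max X a b n \<omega> \<le> x \<longleftrightarrow> (\<forall>i\<in>{1..n}. X i \<omega> \<le> ?t)" for \<omega>
    using \<open>1 \<le> n\<close> \<open>0 < a n\<close> by (simp add: renorm_max_def pos_divide_le_eq algebra_simps)
  then have "renorm_max X a b n -` {..x} \<inter> space M = (\<Inter>i\<in>{1..n}. X i -` {..?t} \<inter> space M)"
    using \<open>1 \<le> n\<close> by auto
  then have "cdf (distr M borel (renorm_max X a b n)) x = prob (\<Inter>i\<in>{1..n}. X i -` {..?t} \<inter> space M)"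
    by (simp add: cdf_def measure_distr[OF W])
  also have "\<dots> = (\<Prod>i\<in>{1..n}. prob (X i -` {..?t} \<inter> space M))"
    using \<open>1 \<le> n\<close> by (intro indep_varsD[OF indep]) auto
  also have "\<dots> = (\<Prod>i\<in>{1..n}. F ?t)"
  proof (rule prod.cong)
    fix i assume "i \<in> {1..n}"
    then show "prob (X i -` {..?t} \<inter> space M) = F ?t"
      using ident[of i] X[of i] by (auto simp: cdf_def measure_distr[symmetric])
  qed simp
  finally show ?thesis by simp
qed

lemma pdf_of_pos_iff: "0 < pdf_of H x \<longleftrightarrow> (\<exists>D>0. (H has_real_derivative D) (at x))"
  unfolding pdf_of_def
  by (metis DERIV_imp_deriv less_irrefl real_differentiable_def)

lemma pdf_of_pos_imp_derivative:
  "0 < pdf_of H x \<Longrightarrow> (H has_real_derivative pdf_of H x) (at x)"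
  by (auto simp: pdf_of_def DERIV_deriv_iff_real_differentiable split: if_splits)

lemma pdf_of_mono_nonneg:
  assumes "mono H" shows "0 \<le> pdf_of H x"
proof (cases "H differentiable (at x)")
  case True
  then have "(H has_real_derivative deriv H x) (at x)"
    by (simp add: DERIV_deriv_iff_real_differentiable)
  then have "0 \<le> deriv H x"
    by (rule mono_on_imp_deriv_nonneg[of UNIV, rotated]) (use assms in auto)
  then show ?thesis by (simp add: pdf_of_def)
qed (simp add: pdf_of_def)

text \<open>At a zero, a nonnegative function has a minimum, so its derivative cannot be positive there.\<close>

lemma pos_of_pdf_of_pos:
  assumes "\<And>x. 0 \<le> H x" "0 < pdf_of H x" shows "(0::real) < H x"
proof -
  obtain d where "d > 0" "\<And>s. 0 < s \<Longrightarrow> s < d \<Longrightarrow> H (x - s) < H x"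
    using DERIV_pos_inc_left[OF pdf_of_pos_imp_derivative[OF assms(2)] assms(2)] by auto
  from this(2)[of "d / 2"] this(1) assms(1)[of "x - d / 2"] show ?thesis by simp
qed

text \<open>In one direction this is the chain rule. Conversely \<open>F\<close> is recovered from \<open>H\<close> by the \<open>n\<close>-th
root, which is differentiable at \<open>H x\<close> because \<open>H x > 0\<close> wherever \<open>H\<close> has positive derivative.
Thus the density of the maximum is positive exactly on the rescaled set where that of the sample
is.\<close>

lemma pdf_of_affine_power_pos_iff:
  fixes a b :: real
  assumes F: "\<And>x. 0 \<le> F x" and "0 < a" "1 \<le> n" and H: "\<And>x. H x = F (a * x + b) ^ n"
  shows "0 < pdf_of H x \<longleftrightarrow> 0 < pdf_of F (a * x + b)"
proof
  assume F': "0 < pdf_of F (a * x + b)"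
  note D = pdf_of_pos_imp_derivative[OF F']
  have "(H has_real_derivative real n * F (a * x + b) ^ (n - 1) * (pdf_of F (a * x + b) * a)) (at x)"
    unfolding H[abs_def]
    by (auto intro!: derivative_eq_intros DERIV_chain'[where g = F and f = "\<lambda>x. a * x + b", OF _ D])
  moreover have "0 < real n * F (a * x + b) ^ (n - 1) * (pdf_of F (a * x + b) * a)"
    using \<open>1 \<le> n\<close> \<open>0 < a\<close> F' pos_of_pdf_of_pos[OF F F'] by simp
  ultimately show "0 < pdf_of H x" unfolding pdf_of_pos_iff by blast
next
  assume H': "0 < pdf_of H x"
  have H_nonneg: "0 \<le> H y" for y by (simp add: H F)
  have "0 < H x" by (rule pos_of_pdf_of_pos[OF H_nonneg H'])
  let ?t = "a * x + b"
  have "((\<lambda>t. (t - b) / a) has_real_derivative 1 / a) (at ?t)"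
    using \<open>0 < a\<close> by (auto intro!: derivative_eq_intros)
  moreover have "(H has_real_derivative pdf_of H x) (at ((?t - b) / a))"
    using pdf_of_pos_imp_derivative[OF H'] \<open>0 < a\<close> by simp
  ultimately have "((\<lambda>t. H ((t - b) / a)) has_real_derivative pdf_of H x * (1 / a)) (at ?t)"
    by (rule DERIV_chain')
  moreover have "(root n has_real_derivative inverse (real n * root n (H x) ^ (n - 1))) (at (H ((?t - b) / a)))"
    using DERIV_real_root[of n "H x"] \<open>1 \<le> n\<close> \<open>0 < H x\<close> \<open>0 < a\<close> by simp
  ultimately have "((\<lambda>t. root n (H ((t - b) / a))) has_real_derivative
      inverse (real n * root n (H x) ^ (n - 1)) * (pdf_of H x * (1 / a))) (at ?t)"
    by (rule DERIV_chain')
  moreover have "(\<lambda>t. root n (H ((t - b) / a))) = F"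
    using \<open>0 < a\<close> \<open>1 \<le> n\<close> F by (auto simp: H real_root_power_cancel)
  moreover have "0 < inverse (real n * root n (H x) ^ (n - 1)) * (pdf_of H x * (1 / a))"
    using \<open>1 \<le> n\<close> \<open>0 < H x\<close> \<open>0 < a\<close> H' by simp
  ultimately show "0 < pdf_of F ?t" unfolding pdf_of_pos_iff by metis
qed

lemma mem_interval_of_between_closure:
  fixes S :: "real set"
  assumes "is_interval S" "closure (ereal ` S) = {lo..hi}" "lo < ereal t" "ereal t < hi"
  shows "t \<in> S"
proof -
  have "lo \<in> {..<ereal t} \<inter> closure (ereal ` S)" "hi \<in> {ereal t<..} \<inter> closure (ereal ` S)"
    using assms by auto
  then have "{..<ereal t} \<inter> ereal ` S \<noteq> {}" "{ereal t<..} \<inter> ereal ` S \<noteq> {}"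
    by (metis empty_iff open_Int_closure_eq_empty open_lessThan open_greaterThan)+
  then obtain s s' where "s \<in> S" "s < t" "s' \<in> S" "t < s'" by auto
  then show ?thesis
    using assms(1) by (intro mem_is_interval_1_I[of S s s' t]) auto
qed

lemma affine_between_iff:
  fixes lo hi :: ereal and a b x :: real
  assumes "0 < a"
  shows "(lo - ereal b) / ereal a < ereal x \<longleftrightarrow> lo < ereal (a * x + b)"
    and "ereal x < (hi - ereal b) / ereal a \<longleftrightarrow> ereal (a * x + b) < hi"
  using assms by (cases lo; cases hi; simp add: field_simps)+

section \<open>The Stein identity for the renormalized maximum\<close>

theorem lemma2p1:
  fixes \<alpha> :: real
    and M :: "'m measure" and X :: "nat \<Rightarrow> 'm \<Rightarrow> real" and F :: "real \<Rightarrow> real"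
    and a b :: "nat \<Rightarrow> real" and n :: nat
    and S :: "real set" and lo hi :: ereal
    and W :: "'m \<Rightarrow> real" and f\<^sub>n \<rho>\<^sub>n :: "real \<Rightarrow> real" and l\<^sub>n u\<^sub>n :: ereal
    and N :: "'g measure" and G :: "'g \<Rightarrow> real"
    and h \<phi>\<^sub>h :: "real \<Rightarrow> real"
  assumes alpha: "0 < \<alpha>"
    \<comment> \<open>the sample \<open>X\<^sub>1, X\<^sub>2, \<dots>\<close> and the normalizing constants\<close>
    and M: "prob_space M"
    and indep: "prob_space.indep_vars M (\<lambda>_. borel) X {1..}"
    and ident: "\<And>i. 1 \<le> i \<Longrightarrow> cdf (distr M borel (X i)) = F"
    and a_pos: "\<And>k. 1 \<le> k \<Longrightarrow> 0 < a k"
    and attraction: "\<And>x. (\<lambda>k. F (a k * x + b k) ^ k) \<longlonglongrightarrow> frechet_cdf \<alpha> x"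
    \<comment> \<open>the set where \<open>F' > 0\<close> and its closure \<open>[lo, hi]\<close> in the extended reals\<close>
    and S: "S = {x. 0 < pdf_of F x}"
    and S_interval: "is_interval S"
    and S_closure: "closure (ereal ` S) = {lo..hi}"
    \<comment> \<open>\<open>W\<^sub>n\<close>, its density, its score, and the endpoints of its support\<close>
    and n: "1 \<le> n"
    and W: "W = renorm_max X a b n"
    and fn: "f\<^sub>n = pdf_of (cdf (distr M borel W))"
    and W_density: "distributed M lborel W (\<lambda>x. ennreal (f\<^sub>n x))"
    and fn_diff: "\<exists>K. finite K \<and> (\<forall>x. a n * x + b n \<in> S \<longrightarrow> x \<notin> K \<longrightarrow> f\<^sub>n differentiable (at x))"
    and rho: "\<rho>\<^sub>n = score f\<^sub>n"
    and ln: "l\<^sub>n = (lo - ereal (b n)) / ereal (a n)"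
    and un: "u\<^sub>n = (hi - ereal (b n)) / ereal (a n)"
    and ln_nonneg: "0 \<le> l\<^sub>n"
    \<comment> \<open>the Frechet variable, the test function and the solution of the Stein equation\<close>
    and N: "prob_space N"
    and G: "G \<in> borel_measurable N"
    and G_cdf: "cdf (distr N borel G) = frechet_cdf \<alpha>"
    and h: "h \<in> borel_measurable borel"
    and h_G: "integrable N (\<lambda>\<omega>. h (G \<omega>))"
    and phi: "\<phi>\<^sub>h = frechet_stein \<alpha> (\<integral>\<omega>. h (G \<omega>) \<partial>N) h"
    and phi_class: "extends_into \<phi>\<^sub>h (stein_class \<alpha> f\<^sub>n l\<^sub>n u\<^sub>n)"
    \<comment> \<open>the other expectations in the identity exist\<close>
    and h_W: "integrable M (\<lambda>\<omega>. h (W \<omega>))"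
    and rhs_W: "integrable M (\<lambda>\<omega>. \<phi>\<^sub>h (W \<omega>) *
          (1 - W \<omega> powr \<alpha> * ((\<alpha> + 1) / \<alpha> + W \<omega> / \<alpha> * \<rho>\<^sub>n (W \<omega>))))"
  shows "(\<integral>\<omega>. h (W \<omega>) \<partial>M) - (\<integral>\<omega>. h (G \<omega>) \<partial>N) =
    \<alpha> * (\<integral>\<omega>. \<phi>\<^sub>h (W \<omega>) *
          (1 - W \<omega> powr \<alpha> * ((\<alpha> + 1) / \<alpha> + W \<omega> / \<alpha> * \<rho>\<^sub>n (W \<omega>))) \<partial>M)"
proof -
  interpret M: prob_space M by (rule M)
  interpret N: prob_space N by (rule N)
  define H where "H = cdf (distr M borel W)"
  note a_n = a_pos[OF n]
  have W_meas [measurable]: "W \<in> borel_measurable M"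
    using distributed_measurable[OF W_density] by simp
  have H_eq: "H x = F (a n * x + b n) ^ n" for x
    unfolding H_def W using W_meas W by (intro cdf_renorm_max[where a = a] M indep ident n a_n) auto
  have F_nonneg: "0 \<le> F x" for x
    using ident[of 1] by (auto simp: cdf_def)
  have "mono H"
    unfolding H_def using prob_space.real_distribution_distr[OF M W_meas]
    by (intro monoI finite_borel_measure.cdf_nondecreasing real_distribution.finite_borel_measure_M)
  then have fn_nonneg: "0 \<le> f\<^sub>n x" for x
    unfolding fn H_def[symmetric] by (rule pdf_of_mono_nonneg)
  have fn_pos: "0 < f\<^sub>n x \<longleftrightarrow> a n * x + b n \<in> S" for x
    unfolding fn H_def[symmetric] S
    using pdf_of_affine_power_pos_iff[where F = F and H = H, OF F_nonneg a_n n H_eq] by simp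
  have inside: "a n * x + b n \<in> S" if "x \<in> einterval l\<^sub>n u\<^sub>n" for x
    using that mem_interval_of_between_closure[OF S_interval S_closure]
    by (simp add: einterval_iff ln un affine_between_iff[OF a_n])
  have endpoints: "l\<^sub>n \<le> ereal x" "ereal x \<le> u\<^sub>n" if "0 < f\<^sub>n x" for x
  proof -
    have "ereal (a n * x + b n) \<in> {lo..hi}"
      using that closure_subset[of "ereal ` S"] by (auto simp: fn_pos S_closure)
    then show "l\<^sub>n \<le> ereal x" "ereal x \<le> u\<^sub>n"
      unfolding ln un by (simp_all add: affine_between_iff[OF a_n] flip: not_less)
  qed
  have fn_outside: "AE x in lborel. x \<notin> einterval l\<^sub>n u\<^sub>n \<longrightarrow> f\<^sub>n x = 0"
    using AE_lborel_singleton[of "real_of_ereal l\<^sub>n"] AE_lborel_singleton[of "real_of_ereal u\<^sub>n"]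
  proof eventually_elim
    case (elim x)
    then show ?case
      using endpoints[of x] fn_nonneg[of x] by (force simp: einterval_iff less_le)
  qed
  \<comment> \<open>Otherwise the density of \<open>W\<close> would vanish almost everywhere.\<close>
  have "l\<^sub>n < u\<^sub>n"
  proof (rule ccontr)
    assume "\<not> l\<^sub>n < u\<^sub>n"
    then have "einterval l\<^sub>n u\<^sub>n = {}" by (auto simp: einterval_def)
    then have "AE x in lborel. ennreal (f\<^sub>n x) = 0"
      using fn_outside by auto
    then have "emeasure (distr M lborel W) UNIV = 0"
      unfolding distributed_distr_eq_density[OF W_density]
      using distributed_borel_measurable[OF W_density]
      by (subst emeasure_density) (auto simp: nn_integral_0_iff_AE)
    then show False
      by (simp add: emeasure_distr M.emeasure_space_1)
  qed
  obtain K where "finite K" and K: "\<And>x. a n * x + b n \<in> S \<Longrightarrow> x \<notin> K \<Longrightarrow> f\<^sub>n differentiable (at x)"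
    using fn_diff by blast
  define m where "m = (\<integral>\<omega>. h (G \<omega>) \<partial>N)"
  obtain \<phi> where \<phi>: "\<phi> \<in> stein_class \<alpha> f\<^sub>n l\<^sub>n u\<^sub>n" and \<phi>_eq: "\<And>x. 0 < x \<Longrightarrow> \<phi> x = \<phi>\<^sub>h x"
    using phi_class by (auto simp: extends_into_def)
  have G_density: "distributed N lborel G (\<lambda>x. ennreal (frechet_density \<alpha> x))"
    by (intro distributed_frechet alpha N G G_cdf)
  have stein: "AE x in lborel. 0 < x \<longrightarrow> deriv \<phi> x * x powr (\<alpha> + 1) + \<alpha> * \<phi> x = h x - m"
  proof (rule AE_frechet_stein_equation[OF alpha])
    show "integrable lborel (\<lambda>x. frechet_density \<alpha> x * h x)"
      using distributed_integrable[OF G_density, of h] h h_G alpha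
      by (simp add: frechet_density_nonneg)
    show "integrable lborel (frechet_density \<alpha>)"
      using distributed_integrable[OF G_density, of "\<lambda>_. 1"] alpha
      by (simp add: frechet_density_nonneg)
    show "\<phi> x = frechet_stein \<alpha> m h x" if "0 < x" for x
      using \<phi>_eq[OF that] by (simp add: phi m_def)
    show "\<phi> differentiable (at x)" for x
      using \<phi> by (auto simp: stein_class_def differentiable_on_def)
  qed
  show ?thesis
    unfolding m_def[symmetric] rho
  proof (rule stein_identity_of_density[OF alpha M W_density fn_nonneg ln_nonneg \<open>l\<^sub>n < u\<^sub>n\<close> \<open>finite K\<close>
        _ _ fn_outside _ \<phi> stein h h_W \<phi>_eq])
    show "(H has_real_derivative f\<^sub>n x) (at x)" if "x \<in> einterval l\<^sub>n u\<^sub>n" for x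
      using inside[OF that] pdf_of_pos_imp_derivative[of H x] by (simp add: fn_pos[symmetric] fn H_def)
  qed (use inside K rhs_W in \<open>auto simp: fn_pos rho\<close>)
qed

end
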